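(* Let $m,n$ be positive integers. A graph $G\in G_{m,n}$ must have one of the following: (1) no cut-vertices and no bridges; (2) (exactly) one cut-vertex and no bridges; (3) (exactly) two cut-vertices and one bridge; (4) (exactly) two cut-vertices and two bridges; (5) (exactly) three cut-vertices and four bridges. Moreover, if $G$ has at least one cut-vertex, then $G$ is traceable.
   Context: All graphs are finite and simple. For positive integers $m,n$, $G_{m,n}$ denotes the class of all simple graphs that have the same degree sequence as the disjoint union $K_m\cup K_n$ of two cliques (that is, $m$ vertices of degree $m-1$ and $n$ further vertices of degree $n-1$) but are not isomorphic to $K_m\cup K_n$. (Every such graph is connected.) A cut-vertex is a vertex whose removal disconnects the graph; a bridge is an edge whose removal increases the number of connected components. A graph is traceable if it contains a Hamiltonian path, i.e. a path visiting every vertex exactly once. *)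

theory Defs
  imports "Graph_Theory.Graph_Theory" "HOL-Library.Multiset"
begin

text \<open>
  A finite simple graph is a \<open>pair_graph\<close>: a finite, loop-free digraph with a symmetric arc
  relation, in which the undirected edge \<open>{u, v}\<close> is the pair of arcs \<open>(u, v)\<close>, \<open>(v, u)\<close>.
\<close>

definition complete_on :: "'a set \<Rightarrow> 'a pair_pre_digraph" where
  "complete_on V = \<lparr> pverts = V, parcs = {(u, v). u \<in> V \<and> v \<in> V \<and> u \<noteq> v} \<rparr>"

definition two_cliques :: "nat \<Rightarrow> nat \<Rightarrow> (nat, nat \<times> nat) pre_digraph" where
  "two_cliques m n =
    union (with_proj (complete_on {..<m})) (with_proj (complete_on {m..<m + n}))"

text \<open>In a symmetric digraph the out-degree counts the neighbours. The degree sequence is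
  unordered, hence a multiset.\<close>

definition degree_sequence :: "('a, 'b) pre_digraph \<Rightarrow> nat multiset" where
  "degree_sequence G = image_mset (out_degree G) (mset_set (verts G))"

definition clique_union_class :: "nat \<Rightarrow> nat \<Rightarrow> 'a pair_pre_digraph set" where
  "clique_union_class m n =
    {G. pair_graph G \<and>
        degree_sequence (with_proj G) = degree_sequence (two_cliques m n) \<and>
        \<not> digraph_iso (with_proj G) (two_cliques m n)}"

text \<open>For symmetric digraphs strongly connected components are connected components.\<close>

definition num_components :: "('a, 'b) pre_digraph \<Rightarrow> nat" where
  "num_components G = card (pre_digraph.sccs G)"

definition cut_vertices :: "'a pair_pre_digraph \<Rightarrow> 'a set" where
  "cut_vertices G =
    {v \<in> pverts G. num_components (with_proj G) < num_components (pre_digraph.del_vert (with_proj G) v)}"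

text \<open>In a connected graph, this says that removing the vertex leaves a disconnected graph.
  (\<open>connected\<close> is false for the graph without vertices.)\<close>

lemma num_components_eq_1_iff:
  assumes "fin_digraph G" "symmetric G"
  shows "num_components G = 1 \<longleftrightarrow> connected G"
proof -
  interpret fin_digraph G by fact
  have conn: "connected G \<longleftrightarrow> strongly_connected G"
    by (simp add: connected_def strongly_connected_def reachable_mk_symmetric_eq[OF assms(2)])
  have num: "num_components G = card sccs_verts"
    by (simp add: num_components_def card_sccs_verts)
  show ?thesis
  proof
    assume "num_components G = 1"
    then obtain S where S: "sccs_verts = {S}"
      unfolding num by (auto simp: card_1_singleton_iff)
    have sub: "S \<noteq> {}" "\<forall>u\<in>S. \<forall>v\<in>S. u \<rightarrow>\<^sup>*\<^bsub>G\<^esub> v"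
      using S in_sccs_verts_conv_reachable[of S] by auto
    have "u \<in> S" if "u \<in> verts G" for u
      using scc_of_in_sccs_verts[OF that] in_scc_of_self[OF that] S by auto
    moreover have "S \<subseteq> verts G"
    proof
      fix y assume y: "y \<in> S"
      from bspec[OF bspec[OF sub(2) y] y] show "y \<in> verts G" by (rule reachable_in_verts(1))
    qed
    ultimately have "verts G = S" by auto
    with sub show "connected G"
      by (auto simp: conn strongly_connected_def)
  next
    assume "connected G"
    then have sc: "verts G \<noteq> {}" "\<And>u v. u \<in> verts G \<Longrightarrow> v \<in> verts G \<Longrightarrow> u \<rightarrow>\<^sup>*\<^bsub>G\<^esub> v"
      by (auto simp: conn strongly_connected_def)
    have "S = verts G" if "S \<in> sccs_verts" for S
    proof -
      have *: "S \<noteq> {}" "\<And>u v. u \<in> S \<Longrightarrow> v \<in> S \<Longrightarrow> u \<rightarrow>\<^sup>*\<^bsub>G\<^esub> v"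
        "\<And>u v. u \<in> S \<Longrightarrow> v \<notin> S \<Longrightarrow> \<not> (u \<rightarrow>\<^sup>*\<^bsub>G\<^esub> v) \<or> \<not> (v \<rightarrow>\<^sup>*\<^bsub>G\<^esub> u)"
        using that in_sccs_verts_conv_reachable[of S] by auto
      obtain x where x: "x \<in> S" using *(1) by blast
      have sub: "S \<subseteq> verts G"
      proof
        fix y assume "y \<in> S"
        then show "y \<in> verts G" using *(2)[of y y] reachable_in_verts(1) by blast
      qed
      moreover have "y \<in> S" if "y \<in> verts G" for y
        using *(3)[OF x, of y] sc(2)[of x y] sc(2)[of y x] x sub that by blast
      ultimately show ?thesis by blast
    qed
    moreover have "verts G \<in> sccs_verts"
      unfolding in_sccs_verts_conv_reachable
      using sc reachable_in_verts(2) by blast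
    ultimately have "sccs_verts = {verts G}" by blast
    then show "num_components G = 1" by (simp add: num)
  qed
qed

lemma num_components_eq_0_iff:
  assumes "fin_digraph G"
  shows "num_components G = 0 \<longleftrightarrow> verts G = {}"
proof -
  interpret fin_digraph G by fact
  have num: "num_components G = card sccs_verts"
    by (simp add: num_components_def card_sccs_verts)
  have sub: "S \<subseteq> verts G" if "S \<in> sccs_verts" for S
  proof
    fix y assume y: "y \<in> S"
    have "\<forall>u\<in>S. \<forall>v\<in>S. u \<rightarrow>\<^sup>*\<^bsub>G\<^esub> v"
      using that[unfolded in_sccs_verts_conv_reachable] by (elim conjE)
    from bspec[OF bspec[OF this y] y] show "y \<in> verts G" by (rule reachable_in_verts(1))
  qed
  have "finite sccs_verts"
    by (rule finite_subset[of _ "Pow (verts G)"]) (use sub in auto)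
  moreover have "sccs_verts = {} \<longleftrightarrow> verts G = {}"
  proof
    show "verts G = {}" if "sccs_verts = {}"
      using scc_of_in_sccs_verts that by auto
    show "sccs_verts = {}" if "verts G = {}"
    proof (rule equals0I)
      fix S assume S: "S \<in> sccs_verts"
      then have "S \<noteq> {}" unfolding in_sccs_verts_conv_reachable by (elim conjE)
      with sub[OF S] that show False by simp
    qed
  qed
  ultimately show ?thesis by (simp add: num)
qed

lemma cut_vertices_of_connected:
  assumes "pair_graph G" "connected (with_proj G)"
  shows "cut_vertices G =
    {v \<in> pverts G. pverts G \<noteq> {v} \<and> \<not> connected (pre_digraph.del_vert (with_proj G) v)}"
proof -
  interpret pair_graph G by fact
  have 1: "num_components (with_proj G) = 1"
    using assms(2) num_components_eq_1_iff[OF fin_digraph_axioms sym_arcs] by simp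
  have "1 < num_components (del_vert v) \<longleftrightarrow> pverts G \<noteq> {v} \<and> \<not> connected (del_vert v)"
    if "v \<in> pverts G" for v
  proof -
    have fin: "fin_digraph (del_vert v)"
      by (rule fin_digraph_del_vert)
    have "symmetric (del_vert v)"
      using pair_sym_arcs by (auto simp: symmetric_def arcs_ends_def arc_to_ends_def del_vert_simps sym_def)
    note num_components_eq_1_iff[OF fin this] num_components_eq_0_iff[OF fin]
    moreover have "verts (del_vert v) = {} \<longleftrightarrow> pverts G = {v}"
      using that by (auto simp: del_vert_simps)
    ultimately show ?thesis by linarith
  qed
  then show ?thesis by (auto simp: cut_vertices_def 1)
qed

definition del_edge :: "'a pair_pre_digraph \<Rightarrow> 'a \<Rightarrow> 'a \<Rightarrow> ('a, 'a \<times> 'a) pre_digraph" where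
  "del_edge G u v = pre_digraph.del_arc (pre_digraph.del_arc (with_proj G) (u, v)) (v, u)"

text \<open>Bridges are collected as unordered pairs, so that each edge counts once.\<close>

definition bridges :: "'a pair_pre_digraph \<Rightarrow> 'a set set" where
  "bridges G = {{u, v} | u v. (u, v) \<in> parcs G \<and>
    num_components (with_proj G) < num_components (del_edge G u v)}"

definition traceable :: "'a pair_pre_digraph \<Rightarrow> bool" where
  "traceable G \<longleftrightarrow> (\<exists>p. vpath p (with_proj G) \<and> set p = pverts G)"

end

theory Submission
  imports Defs
begin

text \<open>
  A graph is called layered here if its vertices carry natural numbers such that two distinct
  vertices are adjacent exactly when their numbers differ by at most one: a path of cliques in
  which consecutive cliques are completely joined. The proof shows that a member of the class that
  has a cut vertex is layered with five layers, of sizes \<open>p, 1, q, p, 1\<close> or \<open>p, q, 1, p, q\<close>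
  with \<open>p, q > 0\<close> (\<open>cut_vertex_layering\<close>).

  Everything can be read off such a layering. The cut vertices are the vertices that form a
  one-element inner layer, because only their removal leaves a gap in the sequence of layers; the
  bridges are the pairs of consecutive one-element layers, because every other edge lies in a
  triangle; and listing the vertices layer by layer is a Hamiltonian path. The five layer sizes
  therefore give \<open>(1, 0)\<close>, \<open>(2, 1)\<close>, \<open>(2, 2)\<close> or \<open>(3, 4)\<close> cut vertices and bridges,
  depending on the pattern and on which of \<open>p\<close> and \<open>q\<close> equal one. Without cut vertices there are
  no bridges, since an end of a bridge is a cut vertex unless it is a leaf, and two adjacent leaves
  would be a whole component of a graph that is connected.

  The layering comes from counting. Let \<open>m \<le> n\<close>, call the \<open>m\<close> vertices of degree \<open>m - 1\<close> small and
  the \<open>n\<close> vertices of degree \<open>n - 1\<close> large, and let \<open>v\<close> separate the remaining \<open>m + n - 1\<close> vertices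
  into \<open>A\<close> and \<open>B\<close>. All neighbours of a vertex of \<open>A\<close> lie in \<open>A \<union> {v}\<close>, so \<open>A\<close> and \<open>B\<close> have at least
  \<open>m - 1\<close> elements, and at least \<open>n - 1\<close> if they contain a large vertex. If \<open>A\<close> has exactly \<open>m - 1\<close>
  elements, then \<open>A \<union> {v}\<close> is a clique, and the degrees leave a single possibility for the
  other side (\<open>layering_of_clique_side\<close>). If both sides have at least \<open>m\<close> elements, both must contain
  large vertices, which forces \<open>n = m + 1\<close> and two cliques of size \<open>m\<close>, whose large vertices
  are the neighbours of \<open>v\<close> (\<open>layering_of_balanced_sides\<close>).
\<close>

section \<open>Connectedness in terms of vertex cuts\<close>

text \<open>
  Separations and the counting arguments deal with sets of vertices that no edge leaves, so
  connectedness is used in this form, on a bare edge relation. The edges need not stay inside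
  \<open>V\<close>; deleting a vertex thus only changes the vertex set.
\<close>

definition linked :: "'a set \<Rightarrow> ('a \<times> 'a) set \<Rightarrow> bool" where
  "linked V E \<longleftrightarrow> V \<noteq> {} \<and> (\<forall>X. X \<subset> V \<longrightarrow> X \<noteq> {} \<longrightarrow> (\<exists>x\<in>X. \<exists>y\<in>V - X. (x, y) \<in> E))"

lemma connected_iff_linked:
  assumes "wf_digraph H" "symmetric H"
  shows "connected H \<longleftrightarrow> linked (verts H) (arcs_ends H)"
proof -
  interpret wf_digraph H by fact
  have conn: "connected H \<longleftrightarrow> strongly_connected H"
    by (simp add: connected_def strongly_connected_def reachable_mk_symmetric_eq[OF assms(2)])
  show ?thesis
  proof
    assume "connected H"
    then have sc: "verts H \<noteq> {}" "\<And>u v. u \<in> verts H \<Longrightarrow> v \<in> verts H \<Longrightarrow> u \<rightarrow>\<^sup>*\<^bsub>H\<^esub> v"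
      by (auto simp: conn strongly_connected_def)
    show "linked (verts H) (arcs_ends H)"
      unfolding linked_def
    proof (intro conjI allI impI, rule sc(1), rule ccontr)
      fix X assume X: "X \<subset> verts H" "X \<noteq> {}"
        and no: "\<not> (\<exists>x\<in>X. \<exists>y\<in>verts H - X. (x, y) \<in> arcs_ends H)"
      obtain x y where xy: "x \<in> X" "y \<in> verts H" "y \<notin> X" using X by blast
      have "x \<rightarrow>\<^sup>*\<^bsub>H\<^esub> y" using sc(2) xy X by blast
      then have "y \<in> X"
      proof (induction rule: reachable_induct)
        case base
        show ?case by fact
      next
        case (step u w)
        then show ?case using no adj_in_verts(2)[OF step(2)] by blast
      qed
      with xy show False by simp
    qed
  next
    assume L: "linked (verts H) (arcs_ends H)"
    have "u \<rightarrow>\<^sup>*\<^bsub>H\<^esub> v" if uv: "u \<in> verts H" "v \<in> verts H" for u v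
    proof (rule ccontr)
      assume nr: "\<not> u \<rightarrow>\<^sup>*\<^bsub>H\<^esub> v"
      let ?X = "{w \<in> verts H. u \<rightarrow>\<^sup>*\<^bsub>H\<^esub> w}"
      have "?X \<subset> verts H" "?X \<noteq> {}" using uv nr by auto
      then obtain x y where "x \<in> ?X" "y \<in> verts H - ?X" "(x, y) \<in> arcs_ends H"
        using L unfolding linked_def by meson
      moreover from this have "u \<rightarrow>\<^sup>*\<^bsub>H\<^esub> y"
        using reachable_adj_trans by blast
      ultimately show False by auto
    qed
    with L show "connected H"
      by (auto simp: conn strongly_connected_def linked_def)
  qed
qed

lemma linked_Int: "linked V (E \<inter> V \<times> V) \<longleftrightarrow> linked V E"
  unfolding linked_def by blast

lemma pair_graph_connected_iff:
  assumes "pair_graph G"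
  shows "connected (with_proj G) \<longleftrightarrow> linked (pverts G) (parcs G)"
proof -
  interpret pair_graph G by fact
  have "arcs_ends (with_proj G) = parcs G" by (auto simp: arcs_ends_def arc_to_ends_def)
  then show ?thesis
    using connected_iff_linked[OF wf_digraph_axioms sym_arcs] by simp
qed

lemma pair_graph_cut_vertices:
  assumes "pair_graph G" "linked (pverts G) (parcs G)"
  shows "cut_vertices G = {v \<in> pverts G. pverts G \<noteq> {v} \<and> \<not> linked (pverts G - {v}) (parcs G)}"
proof -
  interpret pair_graph G by fact
  have "connected (del_vert v) \<longleftrightarrow> linked (pverts G - {v}) (parcs G)" for v
  proof -
    have ends: "arcs_ends (del_vert v) = parcs G \<inter> (pverts G - {v}) \<times> (pverts G - {v})"
      by (auto simp: arcs_ends_def arc_to_ends_def del_vert_simps wellformed')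
    have "symmetric (del_vert v)"
      using pair_sym_arcs unfolding symmetric_def ends by (auto simp: sym_def)
    from connected_iff_linked[OF wf_digraph_del_vert this] show ?thesis
      by (simp add: ends linked_Int del_vert_simps)
  qed
  then show ?thesis
    using cut_vertices_of_connected[OF assms(1)] assms pair_graph_connected_iff by blast
qed

lemma pair_graph_bridges:
  assumes "pair_graph G" "linked (pverts G) (parcs G)"
  shows "bridges G =
    {{u, v} | u v. (u, v) \<in> parcs G \<and> \<not> linked (pverts G) (parcs G - {(u, v), (v, u)})}"
proof -
  interpret pair_graph G by fact
  have 1: "num_components (with_proj G) = 1"
    using assms pair_graph_connected_iff num_components_eq_1_iff[OF fin_digraph_axioms sym_arcs] by blast
  have "1 < num_components (del_edge G u v) \<longleftrightarrow> \<not> linked (pverts G) (parcs G - {(u, v), (v, u)})" for u v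
  proof -
    have fin: "fin_digraph (del_edge G u v)"
      unfolding del_edge_def by (intro fin_digraph.fin_digraph_del_arc fin_digraph_axioms)
    have ends: "arcs_ends (del_edge G u v) = parcs G - {(u, v), (v, u)}"
      and verts: "verts (del_edge G u v) = pverts G"
      by (auto simp: del_edge_def arcs_ends_def arc_to_ends_def pre_digraph.del_arc_simps)
    have sym: "symmetric (del_edge G u v)"
      using pair_sym_arcs unfolding symmetric_def ends by (auto simp: sym_def)
    interpret H: fin_digraph "del_edge G u v" by fact
    have "num_components (del_edge G u v) \<noteq> 0"
      using assms(2) num_components_eq_0_iff[OF fin] by (simp add: verts linked_def)
    then show ?thesis
      using num_components_eq_1_iff[OF fin sym] connected_iff_linked[OF H.wf_digraph_axioms sym]
      unfolding ends verts by linarith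
  qed
  then show ?thesis by (simp add: bridges_def 1)
qed

text \<open>
  A vertex set left only by the edge between \<open>x\<close> and \<open>y\<close> would still be left by one of
  the other two edges of a triangle, according to the side on which the third corner lies.
\<close>

lemma linked_Diff_triangle:
  assumes "linked V E" "sym E" "z \<in> V" "(x, z) \<in> E" "(z, y) \<in> E" "z \<noteq> x" "z \<noteq> y"
  shows "linked V (E - {(x, y), (y, x)})"
  unfolding linked_def
proof (intro conjI allI impI)
  show "V \<noteq> {}" using assms(1) by (simp add: linked_def)
  fix X assume X: "X \<subset> V" "X \<noteq> {}"
  then obtain u w where uw: "u \<in> X" "w \<in> V - X" "(u, w) \<in> E"
    using assms(1) unfolding linked_def by meson
  have E: "(z, x) \<in> E" "(y, z) \<in> E" using assms(2,4,5) by (auto dest: symD)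
  consider "(u, w) \<notin> {(x, y), (y, x)}" | "{u, w} = {x, y}" by auto
  then show "\<exists>x'\<in>X. \<exists>y'\<in>V - X. (x', y') \<in> E - {(x, y), (y, x)}"
  proof cases
    case 1
    then show ?thesis using uw by blast
  next
    case 2
    then have "(u, z) \<in> E - {(x, y), (y, x)}" "(z, w) \<in> E - {(x, y), (y, x)}"
      using E assms by (auto simp: doubleton_eq_iff)
    then show ?thesis using uw assms(3) by blast
  qed
qed

text \<open>
  If a side of the cut at a bridge has another vertex than the end of the bridge, then that end is
  a cut vertex. This holds for both ends, so both sides would be single vertices.
\<close>

lemma no_bridge_of_no_cut_vertex:
  assumes E: "E \<subseteq> V \<times> V" "sym E"
    and two: "V \<noteq> {x, y}" and xy: "(x, y) \<in> E" "x \<noteq> y"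
    and no_cut: "\<And>v. v \<in> V \<Longrightarrow> linked (V - {v}) E"
  shows "linked V (E - {(x, y), (y, x)})"
  unfolding linked_def
proof (intro conjI allI impI, goal_cases)
  case 1
  show ?case using xy E by blast
next
  case (2 X)
  have V: "x \<in> V" "y \<in> V" using E xy by auto
  have sym': "(b, a) \<in> E" if "(a, b) \<in> E" for a b using that E(2) by (auto dest: symD)
  have cross: "\<exists>a\<in>X - {v}. \<exists>b\<in>V - {v} - (X - {v}). (a, b) \<in> E"
    if v: "v \<in> V" and X: "X - {v} \<noteq> {}" "X - {v} \<subset> V - {v}" for v
    using no_cut[OF v] X unfolding linked_def by meson
  show ?case
  proof (cases "X - {x} \<noteq> {} \<and> X - {x} \<subset> V - {x}")
    case True
    from cross[OF V(1)] True show ?thesis by blast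
  next
    case False
    then have X: "X = {x} \<or> V - X = {x}" using 2 by blast
    have "X - {y} \<noteq> {} \<and> X - {y} \<subset> V - {y}"
      using X 2 two V xy(2) by blast
    from cross[OF V(2)] this show ?thesis by blast
  qed
qed

section \<open>Layered graphs\<close>

definition layered :: "'a set \<Rightarrow> ('a \<times> 'a) set \<Rightarrow> ('a \<Rightarrow> nat) \<Rightarrow> bool" where
  "layered V E l \<longleftrightarrow>
    (\<forall>x\<in>V. \<forall>y\<in>V. (x, y) \<in> E \<longleftrightarrow> x \<noteq> y \<and> l x \<le> l y + 1 \<and> l y \<le> l x + 1)"

definition gapless :: "nat set \<Rightarrow> bool" where
  "gapless I \<longleftrightarrow> (\<forall>i\<in>I. \<forall>k\<in>I. {i..k} \<subseteq> I)"

text \<open>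
  An empty layer between two occupied ones cuts the graph. Conversely, a set of vertices that no
  edge leaves contains, with a vertex, its own layer and both neighbouring layers, so it spreads
  over all layers when no layer is empty.
\<close>

lemma layered_linked_iff:
  assumes lay: "layered V E l" and ne: "V \<noteq> {}"
  shows "linked V E \<longleftrightarrow> gapless (l ` V)"
proof
  assume L: "linked V E"
  have "j \<in> l ` V" if x: "x \<in> V" and y: "y \<in> V" and j: "l x \<le> j" "j \<le> l y" for x y j
  proof (rule ccontr)
    assume nj: "j \<notin> l ` V"
    let ?X = "{w \<in> V. l w < j}"
    have "l x \<noteq> j" using nj x by blast
    then have "x \<in> ?X" "y \<in> V - ?X" using x y j by auto
    then have "?X \<subset> V" "?X \<noteq> {}" by blast+
    then obtain u w where "u \<in> ?X" "w \<in> V - ?X" "(u, w) \<in> E"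
      using L unfolding linked_def by meson
    moreover have "l w \<noteq> j" using nj \<open>w \<in> V - ?X\<close> by blast
    ultimately show False using lay unfolding layered_def by force
  qed
  then show "gapless (l ` V)" by (auto simp: gapless_def)
next
  assume gap: "gapless (l ` V)"
  show "linked V E"
    unfolding linked_def
  proof (intro conjI allI impI ne, rule ccontr)
    fix X assume X: "X \<subset> V" "X \<noteq> {}" and no: "\<not> (\<exists>x\<in>X. \<exists>y\<in>V - X. (x, y) \<in> E)"
    have near: "y \<in> X" if "x \<in> X" "y \<in> V" "l x \<le> l y + 1" "l y \<le> l x + 1" for x y
      using that no lay X unfolding layered_def by blast
    have "w \<in> X" if "x \<in> X" "w \<in> V" for x w
      using that
    proof (induction "(l w - l x) + (l x - l w)" arbitrary: x rule: less_induct)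
      case less
      show ?case
      proof (cases "l x \<le> l w + 1 \<and> l w \<le> l x + 1")
        case True
        then show ?thesis using near less.prems by blast
      next
        case False
        define j where "j = (if l x < l w then l x + 1 else l x - 1)"
        have xV: "x \<in> V" using less.prems X by blast
        then have "j \<in> l ` V"
          using gap less.prems False unfolding gapless_def j_def
          by (cases "l x < l w") (auto simp: subset_iff)
        then obtain y where y: "y \<in> V" "l y = j" by blast
        have "y \<in> X" using near[OF less.prems(1) y(1)] y(2) by (simp add: j_def split: if_splits)
        moreover have "(l w - l y) + (l y - l w) < (l w - l x) + (l x - l w)"
          using y(2) False by (auto simp: j_def)
        ultimately show ?thesis using less by blast
      qed
    qed
    with X show False by blast
  qed
qed

text \<open>
  Sorting the vertices by layer yields a Hamiltonian path: successive vertices lie in the same or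
  in consecutive layers because no layer is empty.
\<close>

lemma layered_traceable:
  assumes G: "pair_graph G" and lay: "layered (pverts G) (parcs G) l"
    and gap: "gapless (l ` pverts G)" and ne: "pverts G \<noteq> {}"
  shows "traceable G"
proof -
  interpret pair_graph G by fact
  obtain ys where ys: "set ys = pverts G" "distinct ys"
    using finite_distinct_list[OF pair_finite_verts] by blast
  define xs where "xs = sort_key l ys"
  have xs: "set xs = pverts G" "distinct xs" "sorted (map l xs)"
    using ys by (auto simp: xs_def)
  have step: "(xs ! i, xs ! Suc i) \<in> parcs G" if i: "Suc i < length xs" for i
  proof -
    have in_V: "xs ! i \<in> pverts G" "xs ! Suc i \<in> pverts G"
      using i xs(1) nth_mem[of _ xs] by auto
    have mono: "l (xs ! a) \<le> l (xs ! b)" if "a \<le> b" "b < length xs" for a b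
      using sorted_nth_mono[OF xs(3), of a b] that by simp
    have "l (xs ! Suc i) \<le> l (xs ! i) + 1"
    proof (rule ccontr)
      assume *: "\<not> ?thesis"
      then have "l (xs ! i) + 1 \<in> l ` pverts G"
        using gap in_V unfolding gapless_def by (fastforce simp: subset_iff)
      then obtain k where k: "k < length xs" "l (xs ! k) = l (xs ! i) + 1"
        unfolding xs(1)[symmetric] by (auto simp: in_set_conv_nth)
      show False
        using mono[of k i] mono[of "Suc i" k] k i * by (cases "k \<le> i") auto
    qed
    moreover have "xs ! i \<noteq> xs ! Suc i" using xs(2) i by (simp add: nth_eq_iff_index_eq)
    ultimately show ?thesis
      using lay in_V mono[of i "Suc i"] i unfolding layered_def by fastforce
  qed
  have arcs: "set (vwalk_arcs zs) \<subseteq> parcs G"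
    if "\<And>i. Suc i < length zs \<Longrightarrow> (zs ! i, zs ! Suc i) \<in> parcs G" for zs
    using that
  proof (induction zs rule: vwalk_arcs.induct)
    case (3 x y zs)
    have "(x, y) \<in> parcs G" using "3.prems"[of 0] by simp
    moreover have "set (vwalk_arcs (y # zs)) \<subseteq> parcs G"
      using "3.prems"[of "Suc _"] by (intro "3.IH") auto
    ultimately show ?case by simp
  qed auto
  have "arcs_ends (with_proj G) = parcs G" by (auto simp: arcs_ends_def arc_to_ends_def)
  then have "vpath xs (with_proj G)"
    using arcs[OF step] xs ne by (auto simp: vpath_def vwalk_def)
  with xs show ?thesis by (auto simp: traceable_def)
qed

definition layer :: "'a set \<Rightarrow> ('a \<Rightarrow> nat) \<Rightarrow> nat \<Rightarrow> 'a set" where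
  "layer V l i = {x \<in> V. l x = i}"

lemma layered_subset: "layered V E l \<Longrightarrow> W \<subseteq> V \<Longrightarrow> layered W E l"
  unfolding layered_def by blast

text \<open>
  Deleting a vertex leaves a layered graph, so only a gap in the remaining layers can disconnect it,
  and a gap arises only when the vertex was alone in a layer with layers on both sides.
\<close>

lemma layered_non_cut_vertex_iff:
  assumes lay: "layered V E l" and l: "l ` V = {..k}" "k > 0" and v: "v \<in> V"
  shows "linked (V - {v}) E \<longleftrightarrow> l v = 0 \<or> l v = k \<or> layer V l (l v) \<noteq> {v}"
proof -
  obtain u w where uw: "u \<in> V" "w \<in> V" "l u = 0" "l w = k" using l(1)
    by (metis atMost_iff imageE order_refl zero_le)
  then have "u \<noteq> w" using l(2) by auto
  then have ne: "V - {v} \<noteq> {}" using uw by auto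
  note iff = layered_linked_iff[OF layered_subset[OF lay Diff_subset] ne]
  have le: "l x \<le> k" if "x \<in> V" for x using l(1) that by auto
  show ?thesis
  proof (cases "layer V l (l v) = {v}")
    case False
    then obtain v' where v': "v' \<in> V" "v' \<noteq> v" "l v' = l v" using v by (auto simp: layer_def)
    have "l ` (V - {v}) = l ` V"
    proof
      show "l ` V \<subseteq> l ` (V - {v})"
      proof
        fix i assume "i \<in> l ` V"
        then obtain x where "x \<in> V" "i = l x" by blast
        then have "i = l (if x = v then v' else x)" "(if x = v then v' else x) \<in> V - {v}"
          using v' by auto
        then show "i \<in> l ` (V - {v})" by (rule image_eqI)
      qed
    qed auto
    then show ?thesis using False by (simp add: iff l(1) gapless_def subset_iff)
  next
    case True
    have "l ` (V - {v}) = {..k} - {l v}"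
      unfolding l(1)[symmetric] using True v by (auto simp: layer_def)
    moreover have "gapless ({..k} - {l v}) \<longleftrightarrow> l v = 0 \<or> l v = k"
    proof
      assume g: "gapless ({..k} - {l v})"
      show "l v = 0 \<or> l v = k"
      proof (rule ccontr)
        assume "\<not> ?thesis"
        then have "0 \<in> {..k} - {l v}" "k \<in> {..k} - {l v}" "l v \<in> {0..k}" using le[OF v] by auto
        then show False using g unfolding gapless_def by blast
      qed
    next
      assume "l v = 0 \<or> l v = k"
      then show "gapless ({..k} - {l v})" unfolding gapless_def by force
    qed
    ultimately show ?thesis using True by (simp add: iff)
  qed
qed

lemma card_layered_cut_vertices:
  assumes lay: "layered V E l" and l: "l ` V = {..k}" "k > 0"
  shows "card {v \<in> V. V \<noteq> {v} \<and> \<not> linked (V - {v}) E} =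
    card {i. 0 < i \<and> i < k \<and> card (layer V l i) = 1}"
proof (rule bij_betw_same_card[of l])
  have le: "l x \<le> k" if "x \<in> V" for x using l(1) that by auto
  have "0 \<in> l ` V" "k \<in> l ` V" using l(1) by auto
  then have ne: "V \<noteq> {v}" for v using l(2) by auto
  have eq: "{v \<in> V. V \<noteq> {v} \<and> \<not> linked (V - {v}) E} =
      {v \<in> V. 0 < l v \<and> l v < k \<and> layer V l (l v) = {v}}"
  proof (rule Collect_cong, rule conj_cong[OF refl])
    fix v assume v: "v \<in> V"
    show "V \<noteq> {v} \<and> \<not> linked (V - {v}) E \<longleftrightarrow>
        0 < l v \<and> l v < k \<and> layer V l (l v) = {v}"
      using layered_non_cut_vertex_iff[OF lay l v] ne[of v] le[OF v] by linarith
  qed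
  show "bij_betw l {v \<in> V. V \<noteq> {v} \<and> \<not> linked (V - {v}) E}
      {i. 0 < i \<and> i < k \<and> card (layer V l i) = 1}"
    unfolding eq bij_betw_def
  proof
    show "inj_on l {v \<in> V. 0 < l v \<and> l v < k \<and> layer V l (l v) = {v}}"
      by (rule inj_onI) auto
    show "l ` {v \<in> V. 0 < l v \<and> l v < k \<and> layer V l (l v) = {v}} =
        {i. 0 < i \<and> i < k \<and> card (layer V l i) = 1}" (is "?L = ?R")
    proof
      show "?R \<subseteq> ?L"
      proof
        fix i assume i: "i \<in> ?R"
        then obtain v where v: "layer V l i = {v}" by (auto simp: card_1_singleton_iff)
        then have "v \<in> V" "l v = i" by (auto simp: layer_def)
        with i v show "i \<in> ?L" by force
      qed
    qed auto
  qed
qed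

text \<open>
  An edge is on a triangle as soon as one of its ends shares its layer with a third vertex, or as
  both ends are in one layer, a neighbouring layer being occupied. What remains are the edges
  between consecutive one-element layers, and these separate the lower from the upper layers.
\<close>

lemma layered_bridges:
  assumes lay: "layered V E l" and l: "l ` V = {..k}" "k > 0" and E: "E \<subseteq> V \<times> V"
  shows "{{u, v} | u v. (u, v) \<in> E \<and> \<not> linked V (E - {(u, v), (v, u)})} =
    (\<lambda>i. layer V l i \<union> layer V l (Suc i)) `
      {i. i < k \<and> card (layer V l i) = 1 \<and> card (layer V l (Suc i)) = 1}" (is "?L = ?R")
proof
  have adj: "(x, y) \<in> E \<longleftrightarrow> x \<in> V \<and> y \<in> V \<and> x \<noteq> y \<and> l x \<le> l y + 1 \<and> l y \<le> l x + 1" for x y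
    using lay E unfolding layered_def by blast
  have sym: "sym E" by (rule symI) (auto simp: adj)
  have le: "l x \<le> k" if "x \<in> V" for x using l(1) that by auto
  have ex: "\<exists>x\<in>V. l x = i" if "i \<le> k" for i using l(1) that by (metis atMost_iff imageE)
  have linked: "linked V E"
    using layered_linked_iff[OF lay] l by (auto simp: gapless_def)
  show "?L \<subseteq> ?R"
  proof
    fix e assume "e \<in> ?L"
    then obtain u v where uv: "(u, v) \<in> E" "\<not> linked V (E - {(u, v), (v, u)})" and e: "e = {u, v}"
      by blast
    have no_triangle: "z = u \<or> z = v" if "(u, z) \<in> E \<or> z = u" "(z, v) \<in> E \<or> z = v" "z \<in> V" for z
      using linked_Diff_triangle[OF linked sym, of z u v] uv that by blast
    have ne: "l u \<noteq> l v"
    proof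
      assume luv: "l u = l v"
      have "(if l u = 0 then 1 else l u - 1) \<le> k" using l(2) le[of u] uv(1) by (auto simp: adj)
      from ex[OF this] obtain z where "z \<in> V" "l z = (if l u = 0 then 1 else l u - 1)" by blast
      then have "z \<in> V" "l z \<noteq> l u" "l z \<le> l u + 1" "l u \<le> l z + 1"
        by (auto split: if_splits)
      then show False using no_triangle[of z] luv uv(1) by (auto simp: adj)
    qed
    have single: "layer V l (l u) = {u}" "layer V l (l v) = {v}"
      using no_triangle ne uv(1) unfolding layer_def by (force simp: adj)+
    define i where "i = min (l u) (l v)"
    consider "l u = i" "l v = Suc i" | "l v = i" "l u = Suc i"
      using ne uv(1) unfolding i_def by (force simp: adj)
    then have "e = layer V l i \<union> layer V l (Suc i) \<and> i < k \<and>
        card (layer V l i) = 1 \<and> card (layer V l (Suc i)) = 1"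
      using single e uv(1) le by cases (force simp: adj)+
    then show "e \<in> ?R" by blast
  qed
  show "?R \<subseteq> ?L"
  proof
    fix e assume "e \<in> ?R"
    then obtain i where i: "i < k" "card (layer V l i) = 1" "card (layer V l (Suc i)) = 1"
      and e: "e = layer V l i \<union> layer V l (Suc i)" by blast
    obtain u v where uv: "layer V l i = {u}" "layer V l (Suc i) = {v}"
      using i by (auto simp: card_1_singleton_iff)
    have V: "u \<in> V" "v \<in> V" "l u = i" "l v = Suc i" using uv by (auto simp: layer_def)
    let ?X = "{x \<in> V. l x \<le> i}"
    have "\<not> (\<exists>x\<in>?X. \<exists>y\<in>V - ?X. (x, y) \<in> E - {(u, v), (v, u)})"
    proof
      assume "\<exists>x\<in>?X. \<exists>y\<in>V - ?X. (x, y) \<in> E - {(u, v), (v, u)}"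
      then obtain x y where xy: "x \<in> ?X" "y \<in> V - ?X" "(x, y) \<in> E - {(u, v), (v, u)}" by blast
      then have "l x = i" "l y = Suc i" by (auto simp: adj)
      then have "x = u" "y = v" using xy uv by (auto simp: layer_def)
      with xy show False by simp
    qed
    moreover have "u \<in> ?X" "v \<in> V - ?X" using V by auto
    then have "?X \<subset> V" "?X \<noteq> {}" by blast+
    ultimately have "\<not> linked V (E - {(u, v), (v, u)})" unfolding linked_def by blast
    moreover have "(u, v) \<in> E" using V by (auto simp: adj)
    ultimately show "e \<in> ?L" using e uv by blast
  qed
qed

lemma card_layered_bridges:
  assumes lay: "layered V E l" and l: "l ` V = {..k}" "k > 0" and E: "E \<subseteq> V \<times> V"
  shows "card {{u, v} | u v. (u, v) \<in> E \<and> \<not> linked V (E - {(u, v), (v, u)})} =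
    card {i. i < k \<and> card (layer V l i) = 1 \<and> card (layer V l (Suc i)) = 1}"
  unfolding layered_bridges[OF assms]
proof (rule card_image, rule inj_onI)
  fix i j assume ij: "i \<in> {i. i < k \<and> card (layer V l i) = 1 \<and> card (layer V l (Suc i)) = 1}"
    "j \<in> {i. i < k \<and> card (layer V l i) = 1 \<and> card (layer V l (Suc i)) = 1}"
    and eq: "layer V l i \<union> layer V l (Suc i) = layer V l j \<union> layer V l (Suc j)"
  have "l ` (layer V l i \<union> layer V l (Suc i)) = {i, Suc i}" if "i < k" for i
  proof -
    have "i \<in> l ` V" "Suc i \<in> l ` V" using that l(1) by auto
    then show ?thesis by (auto simp: layer_def image_iff)
  qed
  from this[of i] this[of j] ij have "{i, Suc i} = {j, Suc j}" using eq by simp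
  then show "i = j" by (auto simp: doubleton_eq_iff)
qed

section \<open>Degrees and isomorphism type of a union of two cliques\<close>

lemma out_degree_with_proj: "out_degree (with_proj G) x = card (parcs G `` {x})"
proof -
  have "out_arcs (with_proj G) x = Pair x ` (parcs G `` {x})" by (auto simp: out_arcs_def)
  then show ?thesis by (simp add: out_degree_def card_image inj_on_def)
qed

lemma two_cliques_eq:
  "two_cliques m n = with_proj \<lparr> pverts = {..<m + n},
     parcs = {(u, v). u < m + n \<and> v < m + n \<and> u \<noteq> v \<and> (u < m \<longleftrightarrow> v < m)} \<rparr>"
  by (auto simp: two_cliques_def union_def complete_on_def with_proj_def)

lemma degree_sequence_two_cliques:
  "degree_sequence (two_cliques m n) = replicate_mset m (m - 1) + replicate_mset n (n - 1)"
proof -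
  have deg: "out_degree (two_cliques m n) x = (if x < m then m - 1 else n - 1)" if "x < m + n" for x
  proof -
    have "{(u, v). u < m + n \<and> v < m + n \<and> u \<noteq> v \<and> (u < m \<longleftrightarrow> v < m)} `` {x} =
        (if x < m then {..<m} - {x} else {m..<m + n} - {x})"
      using that by auto
    then show ?thesis
      using that by (simp add: two_cliques_eq out_degree_with_proj card_Diff_singleton_if)
  qed
  have "mset_set (verts (two_cliques m n)) = mset_set {..<m} + mset_set {m..<m + n}"
  proof -
    have "verts (two_cliques m n) = {..<m} \<union> {m..<m + n}" by (auto simp: two_cliques_eq)
    then show ?thesis by (simp only:) (rule mset_set_Union; auto)
  qed
  moreover have "image_mset (out_degree (two_cliques m n)) (mset_set {..<m}) = replicate_mset m (m - 1)"
  proof -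
    have "image_mset (out_degree (two_cliques m n)) (mset_set {..<m}) =
        image_mset (\<lambda>_. m - 1) (mset_set {..<m})"
      by (rule image_mset_cong) (simp add: deg)
    then show ?thesis by (simp add: image_mset_const_eq)
  qed
  moreover have "image_mset (out_degree (two_cliques m n)) (mset_set {m..<m + n}) = replicate_mset n (n - 1)"
  proof -
    have "image_mset (out_degree (two_cliques m n)) (mset_set {m..<m + n}) =
        image_mset (\<lambda>_. n - 1) (mset_set {m..<m + n})"
      by (rule image_mset_cong) (simp add: deg)
    then show ?thesis by (simp add: image_mset_const_eq)
  qed
  ultimately show ?thesis by (simp add: degree_sequence_def)
qed

text \<open>
  Splitting the multiset of vertices along the two blocks of equal degrees, rather than collecting
  the vertices of a given degree, covers the case \<open>m = n\<close> as well.
\<close>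

lemma degree_split_of_degree_sequence:
  assumes "pair_graph G" "degree_sequence (with_proj G) = degree_sequence (two_cliques m n)"
  obtains S where "S \<subseteq> pverts G" "card S = m" "card (pverts G - S) = n"
    "\<And>x. x \<in> S \<Longrightarrow> card (parcs G `` {x}) = m - 1"
    "\<And>x. x \<in> pverts G - S \<Longrightarrow> card (parcs G `` {x}) = n - 1"
proof -
  interpret pair_graph G by fact
  let ?d = "\<lambda>x. card (parcs G `` {x})"
  have "image_mset ?d (mset_set (pverts G)) = replicate_mset m (m - 1) + replicate_mset n (n - 1)"
    using assms(2) unfolding degree_sequence_two_cliques
    by (simp add: degree_sequence_def ext[OF out_degree_with_proj])
  then obtain M N where MN: "mset_set (pverts G) = M + N"
    "image_mset ?d M = replicate_mset m (m - 1)" "image_mset ?d N = replicate_mset n (n - 1)"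
    using image_mset_eq_plusD[of ?d "mset_set (pverts G)"] by fastforce
  define S where "S = set_mset M"
  have M: "M = mset_set S"
  proof (rule multiset_eqI)
    fix x
    have "count M x \<le> count (mset_set (pverts G)) x" by (simp add: MN(1))
    then have "count M x \<le> 1" by (cases "x \<in> pverts G") (auto simp: pair_finite_verts)
    moreover have "x \<in> S \<longleftrightarrow> 0 < count M x" by (simp add: S_def)
    moreover have "count (mset_set S) x = (if x \<in> S then 1 else 0)" by (simp add: S_def)
    ultimately show "count M x = count (mset_set S) x" by (auto simp del: count_greater_zero_iff)
  qed
  have S: "S \<subseteq> pverts G" "finite S"
    using MN(1) pair_finite_verts unfolding S_def
    by (metis finite_set_mset_mset_set set_mset_union sup_ge1) simp
  have "mset_set (pverts G) = mset_set S + mset_set (pverts G - S)"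
    using S pair_finite_verts by (metis mset_set_Diff subset_imp_msubset_mset_set subset_mset.add_diff_inverse)
  then have N: "N = mset_set (pverts G - S)" using MN(1) M by simp
  show ?thesis
  proof (rule that[OF S(1)])
    show "card S = m" using MN(2) M by (metis size_image_mset size_mset_set size_replicate_mset)
    show "card (pverts G - S) = n" using MN(3) N by (metis size_image_mset size_mset_set size_replicate_mset)
    show "?d x = m - 1" if "x \<in> S" for x
    proof -
      have "?d x \<in># image_mset ?d M" using that S_def by auto
      then show ?thesis unfolding MN(2) by (auto split: if_splits)
    qed
    show "?d x = n - 1" if "x \<in> pverts G - S" for x
    proof -
      have "?d x \<in># image_mset ?d N" using that N pair_finite_verts by auto
      then show ?thesis unfolding MN(3) by (auto split: if_splits)
    qed
  qed
qed

lemma digraph_iso_two_cliques: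
  assumes "pair_graph G" and X: "X \<subseteq> pverts G" "card X = m" "card (pverts G - X) = n"
    and adj: "\<And>x y. x \<in> pverts G \<Longrightarrow> y \<in> pverts G \<Longrightarrow>
      (x, y) \<in> parcs G \<longleftrightarrow> x \<noteq> y \<and> (x \<in> X \<longleftrightarrow> y \<in> X)"
  shows "digraph_iso (with_proj G) (two_cliques m n)"
proof -
  interpret pair_graph G by fact
  have fin: "finite X" using X(1) pair_finite_verts finite_subset by blast
  obtain g where g: "bij_betw g X {..<m}"
    using finite_same_card_bij[OF fin, of "{..<m}"] X(2) by auto
  obtain h where h: "bij_betw h (pverts G - X) {m..<m + n}"
    using finite_same_card_bij[of "pverts G - X" "{m..<m + n}"] X(3) pair_finite_verts by auto
  define f where "f x = (if x \<in> X then g x else h x)" for x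
  have fX: "bij_betw f X {..<m}"
    using g by (rule bij_betw_cong[THEN iffD1, rotated]) (simp add: f_def)
  have fY: "bij_betw f (pverts G - X) {m..<m + n}"
    using h by (rule bij_betw_cong[THEN iffD1, rotated]) (simp add: f_def)
  have f: "bij_betw f (pverts G) {..<m + n}"
  proof -
    have "X \<union> (pverts G - X) = pverts G" "{..<m} \<union> {m..<m + n} = {..<m + n}" using X(1) by auto
    then show ?thesis using bij_betw_combine[OF fX fY] by (simp add: disjoint_iff)
  qed
  have lt: "f x < m \<longleftrightarrow> x \<in> X" if "x \<in> pverts G" for x
  proof (cases "x \<in> X")
    case True
    then show ?thesis using fX bij_betwE by fastforce
  next
    case False
    then have "f x \<in> {m..<m + n}" using fY that bij_betwE by blast
    then show ?thesis using False by simp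
  qed
  have inj: "f x = f y \<longleftrightarrow> x = y" if "x \<in> pverts G" "y \<in> pverts G" for x y
    using that f by (auto simp: bij_betw_def inj_on_def)
  define hom where "hom = \<lparr> iso_verts = f, iso_arcs = map_prod f f, iso_head = snd, iso_tail = fst \<rparr>"
  have "inj_on f (pverts G)" "inj_on (map_prod f f) (parcs G)"
    using f inj in_arcsD1 in_arcsD2 by (auto simp: bij_betw_def intro!: inj_onI)
  then have "digraph_isomorphism hom"
    using wf_digraph_axioms by (simp add: digraph_isomorphism_def hom_def)
  moreover have "two_cliques m n = app_iso hom (with_proj G)"
  proof -
    have "{(u, v). u < m + n \<and> v < m + n \<and> u \<noteq> v \<and> (u < m \<longleftrightarrow> v < m)} =
        map_prod f f ` parcs G" (is "?A = ?B")
    proof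
      show "?B \<subseteq> ?A"
      proof
        fix e assume "e \<in> ?B"
        then obtain x y where e: "e = (f x, f y)" "(x, y) \<in> parcs G" by auto
        then have "x \<in> pverts G" "y \<in> pverts G" by (auto dest: wellformed')
        moreover from this have "f x \<in> {..<m + n}" "f y \<in> {..<m + n}" using f by (auto simp: bij_betw_def)
        ultimately show "e \<in> ?A" using e adj lt inj by auto
      qed
      show "?A \<subseteq> ?B"
      proof
        fix e assume "e \<in> ?A"
        then obtain u v where e: "e = (u, v)" "u < m + n" "v < m + n" "u \<noteq> v" "u < m \<longleftrightarrow> v < m" by blast
        then obtain x y where xy: "x \<in> pverts G" "y \<in> pverts G" "u = f x" "v = f y"
          using f by (metis bij_betw_def imageE lessThan_iff)
        then have "(x, y) \<in> parcs G" using adj lt e by auto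
        then show "e \<in> ?B" using e xy by force
      qed
    qed
    moreover have "f ` pverts G = {..<m + n}" using f by (simp add: bij_betw_def)
    ultimately show ?thesis by (simp add: two_cliques_eq app_iso_def hom_def with_proj_def)
  qed
  ultimately show ?thesis unfolding digraph_iso_def by blast
qed

section \<open>The structure of the graphs with a cut vertex\<close>

text \<open>
  The class with its isomorphism condition replaced by what the proof uses: the vertex set does
  not split into two disjoint cliques of sizes \<open>m\<close> and \<open>n\<close>. The set \<open>S\<close> of small vertices is a
  parameter because for \<open>m = n\<close> the degrees do not determine it; any \<open>m\<close> vertices serve then.
\<close>

locale non_split_degrees =
  fixes V :: "'a set" and E :: "('a \<times> 'a) set" and S :: "'a set" and m n :: nat
  assumes fin: "finite V" and E: "E \<subseteq> V \<times> V" and sym: "sym E" and irrefl: "(x, x) \<notin> E"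
    and S: "S \<subseteq> V" "card S = m" "card (V - S) = n"
    and deg_S: "x \<in> S \<Longrightarrow> card (E `` {x}) = m - 1"
    and deg_L: "x \<in> V - S \<Longrightarrow> card (E `` {x}) = n - 1"
    and m_le_n: "m \<le> n" and m_pos: "0 < m"
    and not_split: "\<not> (\<exists>X\<subseteq>V. card X = m \<and> card (V - X) = n \<and>
      (\<forall>x\<in>V. \<forall>y\<in>V. (x, y) \<in> E \<longleftrightarrow> x \<noteq> y \<and> (x \<in> X \<longleftrightarrow> y \<in> X)))"
begin

abbreviation (input) L :: "'a set" where "L \<equiv> V - S"

lemma E_sym: "(x, y) \<in> E \<longleftrightarrow> (y, x) \<in> E"
  using sym by (auto dest: symD)

lemma nbhd: "E `` {x} \<subseteq> V - {x}"
  using E irrefl by auto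

lemma finite_sub: "X \<subseteq> V \<Longrightarrow> finite X"
  using fin finite_subset by blast

lemma card_V: "card V = m + n"
  using S fin card_Diff_subset[OF finite_sub[OF S(1)] S(1)] card_mono[OF fin S(1)] by simp

lemma deg_ge: "x \<in> V \<Longrightarrow> m - 1 \<le> card (E `` {x})"
  using deg_S[of x] deg_L[of x] m_le_n by (cases "x \<in> S") auto

lemma deg_le: "x \<in> V \<Longrightarrow> card (E `` {x}) \<le> n - 1"
  using deg_S[of x] deg_L[of x] m_le_n by (cases "x \<in> S") auto

lemma nbhd_eqI:
  assumes "E `` {x} \<subseteq> W" "W \<subseteq> V" "card W \<le> card (E `` {x})"
  shows "E `` {x} = W"
  using assms finite_sub by (intro card_seteq) auto

text \<open>
  If no edge joins \<open>X\<close> and \<open>Y\<close> and \<open>X\<close> contains a large vertex, then the degrees force at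
  least \<open>n\<close> vertices in \<open>X\<close> and at least \<open>m\<close> in \<open>Y\<close>. Both bounds are attained, so all vertices have
  the largest degree their side allows, and the graph is the excluded union of two cliques.
\<close>

lemma linked: "linked V E"
  unfolding linked_def
proof (intro conjI allI impI)
  show "V \<noteq> {}" using card_V m_pos by auto
  fix X assume X: "X \<subset> V" "X \<noteq> {}"
  show "\<exists>x\<in>X. \<exists>y\<in>V - X. (x, y) \<in> E"
  proof (rule ccontr)
    assume no: "\<not> ?thesis"
    have key: False if XY: "X \<union> Y = V" "X \<inter> Y = {}" "Y \<noteq> {}" "X \<inter> L \<noteq> {}"
      and no: "\<forall>x\<in>X. \<forall>y\<in>Y. (x, y) \<notin> E" for X Y
    proof -
      have nX: "E `` {x} \<subseteq> X - {x}" if "x \<in> X" for x using that no XY nbhd[of x] by blast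
      have nY: "E `` {x} \<subseteq> Y - {x}" if "x \<in> Y" for x
        using that no XY nbhd[of x] E_sym by blast
      have sub: "X \<subseteq> V" "Y \<subseteq> V" using XY by auto
      have fXY: "finite X" "finite Y" using XY finite_sub by blast+
      have cX: "card (E `` {x}) + 1 \<le> card X" if "x \<in> X" for x
        using card_mono[OF _ nX[OF that]] fXY that card_Suc_Diff1[of X x] by simp
      have cY: "card (E `` {x}) + 1 \<le> card Y" if "x \<in> Y" for x
        using card_mono[OF _ nY[OF that]] fXY that card_Suc_Diff1[of Y x] by simp
      have sum: "card X + card Y = m + n"
        using card_Un_disjoint[of X Y] fXY XY card_V by simp
      obtain x0 y0 where x0: "x0 \<in> X" "x0 \<in> L" and y0: "y0 \<in> Y" using XY by blast
      have "n \<le> card X" using cX[OF x0(1)] deg_L[OF x0(2)] m_le_n m_pos by linarith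
      moreover have "m \<le> card Y" using cY[OF y0] deg_ge[of y0] sub y0 m_pos by fastforce
      ultimately have c: "card X = n" "card Y = m" using sum by linarith+
      have deg: "card (E `` {x}) = n - 1 \<and> card (E `` {y}) = m - 1" if xy: "x \<in> X" "y \<in> Y" for x y
      proof (cases "m = n")
        case True
        then show ?thesis using deg_ge deg_le sub xy by (metis le_antisym subsetD)
      next
        case False
        have "Y \<inter> L = {}"
        proof (rule ccontr)
          assume "Y \<inter> L \<noteq> {}"
          then obtain y where "y \<in> Y" "y \<in> L" by blast
          then show False using cY[of y] deg_L[of y] c m_le_n m_pos False by linarith
        qed
        then have "Y \<subseteq> S" using sub by blast
        then have "Y = S" using card_subset_eq[of S Y] finite_sub S c by simp
        then have "x \<in> L" "y \<in> S" using xy XY sub by auto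
        then show ?thesis using deg_L deg_S by simp
      qed
      have "E `` {x} = X - {x}" if x: "x \<in> X" for x
      proof (rule nbhd_eqI[OF nX[OF x]])
        show "X - {x} \<subseteq> V" using sub by blast
        show "card (X - {x}) \<le> card (E `` {x})" using deg[OF x y0] c x fXY by simp
      qed
      moreover have "E `` {y} = Y - {y}" if y: "y \<in> Y" for y
      proof (rule nbhd_eqI[OF nY[OF y]])
        show "Y - {y} \<subseteq> V" using sub by blast
        show "card (Y - {y}) \<le> card (E `` {y})" using deg[OF x0(1) y] c y fXY by simp
      qed
      ultimately have "(x, y) \<in> E \<longleftrightarrow> x \<noteq> y \<and> (x \<in> Y \<longleftrightarrow> y \<in> Y)" if "x \<in> V" "y \<in> V" for x y
        using that XY x0 y0 by (metis (no_types, lifting) Diff_iff Image_singleton_iff UnE disjoint_iff singletonD singletonI)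
      moreover have "V - Y = X" using XY by blast
      ultimately show False using not_split sub c by blast
    qed
    have "card L \<noteq> 0" using S(3) m_le_n m_pos by linarith
    then have "L \<noteq> {}" by (metis card.empty)
    then consider "X \<inter> L \<noteq> {}" | "(V - X) \<inter> L \<noteq> {}" by blast
    then show False
    proof cases
      case 1
      then show ?thesis using key[of X "V - X"] X no by blast
    next
      case 2
      then show ?thesis using key[of "V - X" X] X no E_sym by blast
    qed
  qed
qed

definition separates :: "'a \<Rightarrow> 'a set \<Rightarrow> 'a set \<Rightarrow> bool" where
  "separates v A B \<longleftrightarrow> v \<in> V \<and> A \<noteq> {} \<and> B \<noteq> {} \<and> A \<inter> B = {} \<and> A \<union> B = V - {v} \<and>
    (\<forall>a\<in>A. \<forall>b\<in>B. (a, b) \<notin> E)"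

lemma separates_commute: "separates v A B \<longleftrightarrow> separates v B A"
  unfolding separates_def using E_sym by blast

context
  fixes v A B assumes sep: "separates v A B"
begin

lemma sepD: "v \<in> V" "A \<noteq> {}" "B \<noteq> {}" "A \<inter> B = {}" "A \<union> B = V - {v}" "v \<notin> A" "v \<notin> B"
    "A \<subseteq> V" "B \<subseteq> V" "finite A" "finite B"
    "a \<in> A \<Longrightarrow> b \<in> B \<Longrightarrow> (a, b) \<notin> E"
  using sep finite_sub unfolding separates_def by auto

lemma side_nbhd: "a \<in> A \<Longrightarrow> E `` {a} \<subseteq> insert v A - {a}"
  using sepD(5,12) nbhd[of a] by blast

lemma card_side_nbhd: "a \<in> A \<Longrightarrow> card (insert v A - {a}) = card A"
  using sepD by (simp add: card_Diff_singleton_if card_insert_if)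

lemma side_deg_le: "a \<in> A \<Longrightarrow> card (E `` {a}) \<le> card A"
  using card_mono[OF _ side_nbhd] card_side_nbhd sepD by fastforce

lemma side_complete:
  assumes "a \<in> A" "card A \<le> card (E `` {a})"
  shows "E `` {a} = insert v A - {a}"
proof (rule nbhd_eqI[OF side_nbhd[OF assms(1)]])
  show "insert v A - {a} \<subseteq> V" using sepD by blast
qed (use assms card_side_nbhd in simp)

lemma card_side_ge: "m - 1 \<le> card A"
  using sepD(2,8) side_deg_le deg_ge by (metis all_not_in_conv order_trans subsetD)

lemma card_sides: "card A + card B + 1 = m + n"
  using card_Un_disjoint[of A B] sepD card_V card_Suc_Diff1[OF fin, of v] by simp

lemma neighbour_in_side: "\<exists>a\<in>A. (v, a) \<in> E"
proof -
  have "A \<subset> V" using sepD by blast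
  then obtain a y where "a \<in> A" "y \<in> V - A" "(a, y) \<in> E"
    using linked sepD(2) unfolding linked_def by meson
  then show ?thesis using sepD(5,12) E_sym by blast
qed

end

text \<open>
  Otherwise \<open>A\<close> would consist of all small vertices. The other side would then be a clique of
  \<open>n - 1\<close> large vertices, all joined to \<open>v\<close>, and the neighbour of \<open>v\<close> in \<open>A\<close> exceeds its degree.
\<close>

lemma ex_large_in_side:
  assumes sep: "separates v A B" and "m \<le> card A"
  shows "A \<inter> L \<noteq> {}"
proof
  assume "A \<inter> L = {}"
  note D = sepD[OF sep] and sep' = sep[unfolded separates_commute[of v A]]
  have "A = S" using \<open>A \<inter> L = {}\<close> D(8) S assms(2) finite_sub by (intro card_seteq) auto
  then have B: "B = L - {v}" and "v \<in> L" using D by auto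
  then have "card B = n - 1" using S(3) fin by simp
  then have "E `` {b} = insert v B - {b}" if "b \<in> B" for b
    using that deg_L[of b] B by (intro side_complete[OF sep']) auto
  then have "B \<subseteq> E `` {v}" using D(7) E_sym by blast
  moreover obtain a where a: "a \<in> A" "(v, a) \<in> E" using neighbour_in_side[OF sep] by blast
  ultimately have "insert a B \<subseteq> E `` {v}" by blast
  then have "card (insert a B) \<le> card (E `` {v})"
    using finite_sub nbhd[of v] by (intro card_mono) blast+
  moreover have "a \<notin> B" using a D by blast
  ultimately show False
    using \<open>card B = n - 1\<close> deg_le[OF D(1)] D(11) by simp
qed

text \<open>
  Here \<open>A \<union> {v}\<close> is a clique, \<open>v\<close> is large because it also has a neighbour in \<open>B\<close>, and so
  \<open>B\<close> consists of one small vertex \<open>s\<close> and a set \<open>K\<close> of \<open>n - 1\<close> large ones. A vertex of \<open>K\<close> is adjacent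
  to all but one of the other vertices of \<open>B \<union> {v}\<close>, so each is adjacent to \<open>v\<close> or to \<open>s\<close>. The
  degrees of \<open>v\<close> and \<open>s\<close> allow for \<open>(n - m) + (m - 1)\<close> such adjacencies at most, which is the size
  of \<open>K\<close>: so \<open>v\<close> and \<open>s\<close> are not adjacent, each vertex of \<open>K\<close> is joined to exactly one of them,
  and \<open>K\<close> is a clique. The layers are \<open>A\<close>, \<open>{v}\<close>, the neighbours of \<open>v\<close> in \<open>K\<close>, those of \<open>s\<close>,
  and \<open>{s}\<close>.
\<close>

lemma layering_of_clique_side:
  assumes sep: "separates v A B" and cA: "card A = m - 1"
  shows "\<exists>l. layered V E l \<and> l ` V \<subseteq> {..4} \<and> 1 < m \<and> m < n \<and>
    map (\<lambda>i. card (layer V l i)) [0..<5] = [m - 1, 1, n - m, m - 1, 1]"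
proof -
  note D = sepD[OF sep] and sep' = sep[unfolded separates_commute[of v A]]
  have "1 < m" using cA D by (metis card_gt_0_iff zero_less_diff)
  have NA: "E `` {a} = insert v A - {a}" if "a \<in> A" for a
    using that D cA deg_ge[of a] by (intro side_complete[OF sep]) auto
  have Av: "A \<subseteq> E `` {v}" using NA D(6) E_sym by blast
  have deg_v: "m \<le> card (E `` {v})"
  proof -
    obtain b where b: "b \<in> B" "(v, b) \<in> E" using neighbour_in_side[OF sep'] by blast
    then have "card (insert b A) \<le> card (E `` {v})"
      using Av finite_sub nbhd[of v] by (intro card_mono) blast+
    moreover have "b \<notin> A" using b D by blast
    ultimately show ?thesis using D(10) cA \<open>1 < m\<close> by simp
  qed
  have vL: "v \<in> L" using deg_v deg_S[of v] \<open>1 < m\<close> D(1) by fastforce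
  then have "m < n" using deg_v deg_L \<open>1 < m\<close> by fastforce
  have "A \<subseteq> S"
  proof
    fix a assume a: "a \<in> A"
    then have "card (E `` {a}) = m - 1" using NA card_side_nbhd[OF sep] cA by simp
    then show "a \<in> S" using deg_L[of a] a D(8) \<open>m < n\<close> \<open>1 < m\<close> by (cases "a \<in> S") auto
  qed
  then have "card (S - A) = 1" using card_Diff_subset[of A S] D S cA \<open>1 < m\<close> by simp
  then obtain s where s: "S - A = {s}" by (auto simp: card_1_singleton_iff)
  have sS: "s \<in> S" "s \<notin> A" using s by auto
  then have sB: "s \<in> B" using S(1) D vL by blast
  define K where "K = B - {s}"
  have "S = insert s A" using s \<open>A \<subseteq> S\<close> by blast
  then have "L - {v} = (A \<union> B) - insert s A" using D(5) by auto
  then have "K = L - {v}" using D(4) unfolding K_def by auto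
  then have cK: "card K = n - 1" using S(3) vL fin by simp
  have fK: "finite K" "s \<notin> K" "v \<notin> K" "v \<noteq> s" "K \<subseteq> V" "K \<inter> A = {}" using D sB by (auto simp: K_def)
  have V: "V = A \<union> {v} \<union> K \<union> {s}" using D sB by (auto simp: K_def)
  define P R where "P = E `` {v} \<inter> K" and "R = E `` {s} \<inter> K"
  \<comment> \<open>Keeping track of a possible edge between \<open>v\<close> and \<open>s\<close>: it costs one unit of the degree of
      both, so the count below excludes it.\<close>
  define e where "e = (if (v, s) \<in> E then {s} else {})"
  define e' where "e' = (if (v, s) \<in> E then {v} else {})"
  have Nv: "E `` {v} = A \<union> P \<union> e"
    using Av nbhd[of v] V by (auto simp: P_def e_def)
  have Ns: "E `` {s} = R \<union> e'"
    using nbhd[of s] V D sB E_sym unfolding R_def e'_def by auto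
  have fPR: "finite P" "finite R" using fK by (auto simp: P_def R_def)
  have "card (A \<union> P \<union> e) = card A + card P + card e"
  proof -
    have "A \<inter> P = {}" "(A \<union> P) \<inter> e = {}" using fK sS by (auto simp: P_def e_def)
    moreover have "finite e" by (simp add: e_def)
    ultimately show ?thesis using D fPR by (simp add: card_Un_disjoint)
  qed
  then have cP: "m - 1 + card P + card e = n - 1" using deg_L[OF vL] Nv cA by simp
  have "card (R \<union> e') = card R + card e'"
    using fPR fK by (subst card_Un_disjoint) (auto simp: R_def e'_def)
  then have cR: "card R + card e = m - 1" using deg_S[OF sS(1)] Ns by (simp add: e_def e'_def split: if_splits)
  have NK: "E `` {k} \<subseteq> insert v (insert s K) - {k}" if "k \<in> K" for k
    using side_nbhd[OF sep', of k] that by (auto simp: K_def)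
  have deg_K: "card (E `` {k}) = n - 1" if "k \<in> K" for k
    using deg_L[of k] that \<open>K = L - {v}\<close> by simp
  have PR: "K = P \<union> R"
  proof (rule ccontr)
    assume "K \<noteq> P \<union> R"
    then obtain k where k: "k \<in> K" "(v, k) \<notin> E" "(s, k) \<notin> E" by (auto simp: P_def R_def)
    then have "E `` {k} \<subseteq> K - {k}" using NK[of k] E_sym by blast
    then have "card (E `` {k}) \<le> card (K - {k})" using fK by (intro card_mono) auto
    then show False using deg_K[OF k(1)] cK k fK \<open>m < n\<close> \<open>1 < m\<close> by simp
  qed
  have "card K + card (P \<inter> R) = card P + card R"
    unfolding PR using card_Un_Int[OF fPR] by simp
  then have e0: "card e = 0" and int: "card (P \<inter> R) = 0"
    using cP cR cK by linarith+
  have vs: "(v, s) \<notin> E" "e = {}" "e' = {}"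
    using e0 by (auto simp: e_def e'_def split: if_splits)
  have disj: "P \<inter> R = {}" using int fPR by simp
  have NP: "E `` {k} = insert v K - {k}" if "k \<in> P" for k
  proof (rule nbhd_eqI)
    have "k \<in> K" "(s, k) \<notin> E" using that disj by (auto simp: P_def R_def)
    then show "E `` {k} \<subseteq> insert v K - {k}" "card (insert v K - {k}) \<le> card (E `` {k})"
      using NK[of k] E_sym[of s k] deg_K[of k] fK cK \<open>m < n\<close> by (auto simp: card_Diff_singleton_if)
  qed (use fK D in auto)
  have NR: "E `` {k} = insert s K - {k}" if "k \<in> R" for k
  proof (rule nbhd_eqI)
    have "k \<in> K" "(v, k) \<notin> E" using that disj by (auto simp: P_def R_def)
    then show "E `` {k} \<subseteq> insert s K - {k}" "card (insert s K - {k}) \<le> card (E `` {k})"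
      using NK[of k] E_sym[of v k] deg_K[of k] fK cK \<open>m < n\<close> by (auto simp: card_Diff_singleton_if)
  qed (use fK D sB in auto)
  define l :: "'a \<Rightarrow> nat" where
    "l x = (if x \<in> A then 0 else if x = v then 1 else if x \<in> P then 2 else if x \<in> R then 3 else 4)" for x
  have lA: "l x = 0" if "x \<in> A" for x using that by (simp add: l_def)
  have lv: "l v = 1" using D by (simp add: l_def)
  have lP: "l x = 2" if "x \<in> P" for x using that fK by (auto simp: l_def P_def)
  have lR: "l x = 3" if "x \<in> R" for x using that fK disj by (auto simp: l_def R_def)
  have ls: "l s = 4" using sS fK by (auto simp: l_def P_def R_def)
  note ll = lA lv lP lR ls
  have V': "V = A \<union> {v} \<union> P \<union> R \<union> {s}" using V PR by blast
  have dj: "A \<inter> P = {}" "A \<inter> R = {}" "P \<inter> R = {}" "v \<notin> A" "v \<notin> P" "v \<notin> R"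
      "s \<notin> A" "s \<notin> P" "s \<notin> R" "v \<noteq> s"
    using fK(2-6) disj D(6) sS(2) by (auto simp: P_def R_def)
  have "(x, y) \<in> E \<longleftrightarrow> x \<noteq> y \<and> l x \<le> l y + 1 \<and> l y \<le> l x + 1" if xy: "x \<in> V" "y \<in> V" for x y
  proof -
    have y: "y \<in> A \<or> y = v \<or> y \<in> P \<or> y \<in> R \<or> y = s" using xy(2) V' by blast
    have "(x, y) \<in> E \<longleftrightarrow> y \<in> E `` {x}" by simp
    moreover consider "x \<in> A" | "x = v" | "x \<in> P" | "x \<in> R" | "x = s" using xy(1) V' by blast
    then have "y \<in> E `` {x} \<longleftrightarrow> x \<noteq> y \<and> l x \<le> l y + 1 \<and> l y \<le> l x + 1"
    proof cases
      case 1
      show ?thesis unfolding NA[OF 1] lA[OF 1] using y ll dj 1 by (elim disjE) auto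
    next
      case 2
      have "E `` {v} = A \<union> P" using Nv vs by simp
      then show ?thesis unfolding 2 lv using y ll dj by (elim disjE) auto
    next
      case 3
      show ?thesis unfolding NP[OF 3] lP[OF 3] PR using y ll dj 3 by (elim disjE) auto
    next
      case 4
      show ?thesis unfolding NR[OF 4] lR[OF 4] PR using y ll dj 4 by (elim disjE) auto
    next
      case 5
      have "E `` {s} = R" using Ns vs by simp
      then show ?thesis unfolding 5 ls using y ll dj by (elim disjE) auto
    qed
    ultimately show ?thesis by blast
  qed
  then have "layered V E l" by (simp add: layered_def)
  moreover have "l ` V \<subseteq> {..4}" by (auto simp: l_def)
  moreover have "layer V l 0 = A" "layer V l 1 = {v}" "layer V l 2 = P" "layer V l 3 = R" "layer V l 4 = {s}"
    using V' ll dj by (auto simp: layer_def)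
  ultimately show ?thesis using \<open>1 < m\<close> \<open>m < n\<close> cA cP cR e0
    by (intro exI[of _ l]) (simp add: upt_rec numeral_nat)
qed

text \<open>
  Both sides contain large vertices and so have at least \<open>n - 1\<close> elements, which leaves only
  \<open>n = m + 1\<close> with both sides of size \<open>m\<close>. The large vertices of a side are adjacent to the rest of
  the side and to \<open>v\<close>. The \<open>n - 1\<close> of them exhaust the degree of \<open>v\<close>, so the small vertices are
  adjacent to exactly the rest of their side. The layers are the small and the large vertices of
  \<open>A\<close>, then \<open>{v}\<close>, then the large and the small vertices of \<open>B\<close>.
\<close>

lemma layering_of_balanced_sides:
  assumes sep: "separates v A B" and large: "m \<le> card A" "m \<le> card B"
  shows "\<exists>l p q. layered V E l \<and> l ` V \<subseteq> {..4} \<and> 0 < p \<and> 0 < q \<and>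
    map (\<lambda>i. card (layer V l i)) [0..<5] = [p, q, 1, p, q]"
proof -
  note D = sepD[OF sep] and sep' = sep[unfolded separates_commute[of v A]]
  have AL: "A \<inter> L \<noteq> {}" and BL: "B \<inter> L \<noteq> {}"
    using ex_large_in_side[OF sep] ex_large_in_side[OF sep'] large by auto
  have "n - 1 \<le> card A" using AL deg_L side_deg_le[OF sep] by fastforce
  moreover have "n - 1 \<le> card B" using BL deg_L side_deg_le[OF sep'] by fastforce
  ultimately have n: "n = m + 1" and c: "card A = m" "card B = m"
    using card_sides[OF sep] large by linarith+
  have NAL: "E `` {a} = insert v A - {a}" if "a \<in> A \<inter> L" for a
    using that deg_L[of a] c n by (intro side_complete[OF sep]) auto
  have NBL: "E `` {b} = insert v B - {b}" if "b \<in> B \<inter> L" for b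
    using that deg_L[of b] c n by (intro side_complete[OF sep']) auto
  have Lv: "L - {v} \<subseteq> E `` {v}"
  proof
    fix x assume x: "x \<in> L - {v}"
    then consider "x \<in> A \<inter> L" | "x \<in> B \<inter> L" using D by blast
    then have "v \<in> E `` {x}" using NAL NBL D x by cases auto
    then show "x \<in> E `` {v}" using E_sym by blast
  qed
  have fv: "finite (E `` {v})" using finite_sub nbhd[of v] by blast
  have vL: "v \<in> L"
  proof (rule ccontr)
    assume "v \<notin> L"
    then have "v \<in> S" "L \<subseteq> E `` {v}" using Lv D by auto
    then have "n \<le> m - 1" using card_mono[OF fv, of L] S(3) deg_S by simp
    then show False using n by simp
  qed
  have Nv: "E `` {v} = L - {v}"
    using card_subset_eq[OF fv Lv] deg_L[OF vL] S(3) vL fin by simp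
  have NAS: "E `` {a} = A - {a}" if "a \<in> A \<inter> S" for a
  proof (rule nbhd_eqI)
    have "(a, v) \<notin> E" using Nv that E_sym by blast
    then show "E `` {a} \<subseteq> A - {a}" using side_nbhd[OF sep, of a] that by blast
    show "card (A - {a}) \<le> card (E `` {a})" using that deg_S[of a] c D by simp
  qed (use D in auto)
  have NBS: "E `` {b} = B - {b}" if "b \<in> B \<inter> S" for b
  proof (rule nbhd_eqI)
    have "(b, v) \<notin> E" using Nv that E_sym by blast
    then show "E `` {b} \<subseteq> B - {b}" using side_nbhd[OF sep', of b] that by blast
    show "card (B - {b}) \<le> card (E `` {b})" using that deg_S[of b] c D by simp
  qed (use D in auto)
  define l :: "'a \<Rightarrow> nat" where
    "l x = (if x = v then 2 else if x \<in> A then if x \<in> S then 0 else 1 else if x \<in> S then 4 else 3)" for x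
  have cover: "x \<in> A \<inter> S \<or> x \<in> A \<inter> L \<or> x = v \<or> x \<in> B \<inter> L \<or> x \<in> B \<inter> S" if "x \<in> V" for x
  proof -
    have "x \<in> A \<or> x \<in> B \<or> x = v" using that D(5) by blast
    then show ?thesis using that by blast
  qed
  have l0: "l x = 0" if "x \<in> A \<inter> S" for x using that D by (auto simp: l_def)
  have l1: "l x = 1" if "x \<in> A \<inter> L" for x using that D by (auto simp: l_def)
  have l2: "l v = 2" by (simp add: l_def)
  have l3: "l x = 3" if "x \<in> B \<inter> L" for x using that D by (auto simp: l_def)
  have l4: "l x = 4" if "x \<in> B \<inter> S" for x using that D by (auto simp: l_def)
  note ll = l0 l1 l2 l3 l4
  have "(x, y) \<in> E \<longleftrightarrow> x \<noteq> y \<and> l x \<le> l y + 1 \<and> l y \<le> l x + 1" if xy: "x \<in> V" "y \<in> V" for x y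
  proof -
    note y = cover[OF xy(2)]
    have "(x, y) \<in> E \<longleftrightarrow> y \<in> E `` {x}" by simp
    moreover consider "x \<in> A \<inter> S" | "x \<in> A \<inter> L" | "x = v" | "x \<in> B \<inter> L" | "x \<in> B \<inter> S"
      using cover[OF xy(1)] by blast
    then have "y \<in> E `` {x} \<longleftrightarrow> x \<noteq> y \<and> l x \<le> l y + 1 \<and> l y \<le> l x + 1"
    proof cases
      case 1
      show ?thesis unfolding NAS[OF 1] l0[OF 1] using y ll D 1 by (elim disjE) auto
    next
      case 2
      show ?thesis unfolding NAL[OF 2] l1[OF 2] using y ll D 2 by (elim disjE) auto
    next
      case 3
      show ?thesis unfolding 3 Nv l2 using y ll D vL by (elim disjE) auto
    next
      case 4
      show ?thesis unfolding NBL[OF 4] l3[OF 4] using y ll D 4 by (elim disjE) auto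
    next
      case 5
      show ?thesis unfolding NBS[OF 5] l4[OF 5] using y ll D 5 by (elim disjE) auto
    qed
    ultimately show ?thesis by blast
  qed
  then have "layered V E l" by (simp add: layered_def)
  moreover have "l ` V \<subseteq> {..4}" by (auto simp: l_def)
  moreover have "layer V l 0 = A \<inter> S" "layer V l 1 = A \<inter> L" "layer V l 2 = {v}"
    "layer V l 3 = B \<inter> L" "layer V l 4 = B \<inter> S"
    using D vL by (auto simp: layer_def l_def split: if_splits)
  moreover have "card (B \<inter> L) = card (A \<inter> S)" "card (B \<inter> S) = card (A \<inter> L)"
  proof -
    have "card (A \<inter> S) + card (A \<inter> L) = m"
      using card_Un_disjoint[of "A \<inter> S" "A \<inter> L"] D c by (simp add: Int_Un_distrib[symmetric] Un_absorb1 S(1) Un_commute Int_absorb2 Int_assoc disjoint_iff)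
    moreover have "card (B \<inter> S) + card (B \<inter> L) = m"
      using card_Un_disjoint[of "B \<inter> S" "B \<inter> L"] D c by (simp add: Int_Un_distrib[symmetric] Un_absorb1 S(1) Un_commute Int_absorb2 Int_assoc disjoint_iff)
    moreover have "card (A \<inter> S) + card (B \<inter> S) = m"
    proof -
      have "(A \<inter> S) \<union> (B \<inter> S) = S" using D vL S(1) by blast
      then show ?thesis using card_Un_disjoint[of "A \<inter> S" "B \<inter> S"] D S(2) by (simp add: disjoint_iff)
    qed
    ultimately show "card (B \<inter> L) = card (A \<inter> S)" "card (B \<inter> S) = card (A \<inter> L)" by linarith+
  qed
  moreover have "0 < card (A \<inter> L)" "0 < card (B \<inter> L)"
    using AL BL D by (auto simp: card_gt_0_iff)
  ultimately show ?thesis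
    by (intro exI[of _ l] exI[of _ "card (A \<inter> S)"] exI[of _ "card (A \<inter> L)"])
      (simp add: upt_rec numeral_nat)
qed

lemma cut_vertex_layering:
  assumes "v \<in> V" "V \<noteq> {v}" "\<not> linked (V - {v}) E"
  obtains l p q where "layered V E l" "l ` V \<subseteq> {..4}" "0 < p" "0 < q"
    "map (\<lambda>i. card (layer V l i)) [0..<5] \<in> {[p, 1, q, p, 1], [p, q, 1, p, q]}"
proof -
  obtain A where A: "A \<subset> V - {v}" "A \<noteq> {}" "\<not> (\<exists>x\<in>A. \<exists>y\<in>V - {v} - A. (x, y) \<in> E)"
    using assms unfolding linked_def by blast
  define B where "B = V - {v} - A"
  have "B \<noteq> {}" "A \<inter> B = {}" "A \<union> B = V - {v}" using A(1) unfolding B_def by blast+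
  moreover have "\<forall>a\<in>A. \<forall>b\<in>B. (a, b) \<notin> E" using A(3) unfolding B_def by simp
  ultimately have sep: "separates v A B" using A(2) assms(1) by (simp add: separates_def)
  then have sep': "separates v B A" using separates_commute by blast
  consider "card A = m - 1" | "card B = m - 1" | "m \<le> card A" "m \<le> card B"
    using card_side_ge[OF sep] card_side_ge[OF sep'] by linarith
  then show ?thesis
  proof cases
    case 1
    from layering_of_clique_side[OF sep this] obtain l where
      "layered V E l" "l ` V \<subseteq> {..4}" "1 < m" "m < n"
      "map (\<lambda>i. card (layer V l i)) [0..<5] = [m - 1, 1, n - m, m - 1, 1]" by (elim exE conjE)
    then show ?thesis by (intro that[of l "m - 1" "n - m"]) simp_all
  next
    case 2
    from layering_of_clique_side[OF sep' this] obtain l where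
      "layered V E l" "l ` V \<subseteq> {..4}" "1 < m" "m < n"
      "map (\<lambda>i. card (layer V l i)) [0..<5] = [m - 1, 1, n - m, m - 1, 1]" by (elim exE conjE)
    then show ?thesis by (intro that[of l "m - 1" "n - m"]) simp_all
  next
    case 3
    from layering_of_balanced_sides[OF sep this] obtain l p q where
      "layered V E l" "l ` V \<subseteq> {..4}" "0 < p" "0 < q"
      "map (\<lambda>i. card (layer V l i)) [0..<5] = [p, q, 1, p, q]" by (elim exE conjE)
    then show ?thesis by (intro that[of l p q]) simp_all
  qed
qed

end

section \<open>Counting cut vertices and bridges\<close>

lemma cut_vertices_bridges_of_layering:
  assumes G: "pair_graph G" and lay: "layered (pverts G) (parcs G) l" and l4: "l ` pverts G \<subseteq> {..4}"
    and pq: "0 < p" "0 < q"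
    and sizes: "map (\<lambda>i. card (layer (pverts G) l i)) [0..<5] \<in> {[p, 1, q, p, 1], [p, q, 1, p, q]}"
  shows "(card (cut_vertices G), card (bridges G)) \<in> {(1, 0), (2, 1), (2, 2), (3, 4)}"
    and "traceable G"
proof -
  interpret pair_graph G by fact
  let ?c = "\<lambda>i. card (layer (pverts G) l i)"
  have c: "?c 0 = p \<and> ?c 1 = 1 \<and> ?c 2 = q \<and> ?c 3 = p \<and> ?c 4 = 1 \<or>
      ?c 0 = p \<and> ?c 1 = q \<and> ?c 2 = 1 \<and> ?c 3 = p \<and> ?c 4 = q"
    using sizes by (simp add: upt_rec numeral_nat)
  have "i \<in> l ` pverts G" if "i \<le> 4" for i
  proof -
    have "i \<in> {0, 1, 2, 3, 4}" using that by auto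
    then have "?c i > 0" using c pq by auto
    then have "layer (pverts G) l i \<noteq> {}" by (metis card.empty less_numeral_extra(3))
    then show ?thesis by (auto simp: layer_def)
  qed
  then have img: "l ` pverts G = {..4}" using l4 by auto
  then have ne: "pverts G \<noteq> {}" by auto
  have gap: "gapless (l ` pverts G)" by (auto simp: img gapless_def)
  show "traceable G" by (rule layered_traceable[OF G lay gap ne])
  have linked: "linked (pverts G) (parcs G)" using layered_linked_iff[OF lay ne] gap by simp
  have cuts: "card (cut_vertices G) = card {i. 0 < i \<and> i < 4 \<and> ?c i = 1}"
    using pair_graph_cut_vertices[OF G linked] card_layered_cut_vertices[OF lay img] by simp
  have "parcs G \<subseteq> pverts G \<times> pverts G" by (auto dest: wellformed')
  then have bridges: "card (bridges G) = card {i. i < 4 \<and> ?c i = 1 \<and> ?c (Suc i) = 1}"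
    using pair_graph_bridges[OF G linked] card_layered_bridges[OF lay img] by simp
  have set_sum: "card {i. i \<in> I \<and> P i} = (\<Sum>i\<in>I. if P i then 1 else 0)" if "finite I" for I :: "nat set" and P
    using that by (simp add: sum.If_cases Int_def)
  have "card (cut_vertices G) = card {i. i \<in> {1, 2, 3} \<and> ?c i = 1}"
    unfolding cuts by (rule arg_cong[where f = card]) auto
  also have "\<dots> = (\<Sum>i\<in>{1, 2, 3}. if ?c i = 1 then 1 else 0)"
    by (rule set_sum) simp
  finally have n_cuts: "card (cut_vertices G) =
      (if ?c 1 = 1 then 1 else 0) + (if ?c 2 = 1 then 1 else 0) + (if ?c 3 = 1 then 1 else 0)"
    by simp
  have "card (bridges G) = card {i. i \<in> {0, 1, 2, 3} \<and> ?c i = 1 \<and> ?c (Suc i) = 1}"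
    unfolding bridges by (rule arg_cong[where f = card]) auto
  also have "\<dots> = (\<Sum>i\<in>{0, 1, 2, 3}. if ?c i = 1 \<and> ?c (Suc i) = 1 then 1 else 0)"
    by (rule set_sum) simp
  finally have n_bridges: "card (bridges G) =
      (if ?c 0 = 1 \<and> ?c 1 = 1 then 1 else 0) + (if ?c 1 = 1 \<and> ?c 2 = 1 then 1 else 0) +
      (if ?c 2 = 1 \<and> ?c 3 = 1 then 1 else 0) + (if ?c 3 = 1 \<and> ?c 4 = 1 then 1 else 0)"
    by (simp add: numeral_eq_Suc)
  show "(card (cut_vertices G), card (bridges G)) \<in> {(1, 0), (2, 1), (2, 2), (3, 4)}"
    using c unfolding n_cuts n_bridges by (elim disjE) auto
qed

lemma clique_union_class_degrees:
  assumes G: "G \<in> clique_union_class m n" and pos: "0 < m" "0 < n"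
  obtains S a b where "non_split_degrees (pverts G) (parcs G) S a b"
proof -
  have pg: "pair_graph G" using G by (simp add: clique_union_class_def)
  then interpret pair_graph G .
  obtain S where S: "S \<subseteq> pverts G" "card S = m" "card (pverts G - S) = n"
    "\<And>x. x \<in> S \<Longrightarrow> card (parcs G `` {x}) = m - 1"
    "\<And>x. x \<in> pverts G - S \<Longrightarrow> card (parcs G `` {x}) = n - 1"
    using degree_split_of_degree_sequence[OF pg] G by (auto simp: clique_union_class_def)
  have SS: "pverts G - (pverts G - S) = S" using S(1) by blast
  have no: False if "X \<subseteq> pverts G" "card X = m" "card (pverts G - X) = n"
    "\<forall>x\<in>pverts G. \<forall>y\<in>pverts G. (x, y) \<in> parcs G \<longleftrightarrow> x \<noteq> y \<and> (x \<in> X \<longleftrightarrow> y \<in> X)" for X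
    using digraph_iso_two_cliques[OF pg that(1-3)] that(4) G by (auto simp: clique_union_class_def)
  \<comment> \<open>Exchanging the parts turns a split into sizes \<open>n\<close>, \<open>m\<close> into one into sizes \<open>m\<close>, \<open>n\<close>; this allows
      the assumption \<open>m \<le> n\<close>.\<close>
  have no': False if X: "X \<subseteq> pverts G" "card X = n" "card (pverts G - X) = m"
    "\<forall>x\<in>pverts G. \<forall>y\<in>pverts G. (x, y) \<in> parcs G \<longleftrightarrow> x \<noteq> y \<and> (x \<in> X \<longleftrightarrow> y \<in> X)" for X
  proof (rule no)
    show "pverts G - X \<subseteq> pverts G" "card (pverts G - X) = m" by (use X in auto)
    have "pverts G - (pverts G - X) = X" using X(1) by blast
    then show "card (pverts G - (pverts G - X)) = n" using X by simp
  qed (use X(4) in auto)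
  have basic: "parcs G \<subseteq> pverts G \<times> pverts G" "sym (parcs G)" "(x, x) \<notin> parcs G" for x
    using pair_sym_arcs no_loops' by (auto simp: symmetric_def dest: wellformed')
  show ?thesis
  proof (cases "m \<le> n")
    case True
    have "\<not> (\<exists>X\<subseteq>pverts G. card X = m \<and> card (pverts G - X) = n \<and>
        (\<forall>x\<in>pverts G. \<forall>y\<in>pverts G. (x, y) \<in> parcs G \<longleftrightarrow> x \<noteq> y \<and> (x \<in> X \<longleftrightarrow> y \<in> X)))"
      using no by blast
    then show ?thesis
      by (intro that[of S m n] non_split_degrees.intro) (use S basic True pos in simp_all)
  next
    case False
    have "\<not> (\<exists>X\<subseteq>pverts G. card X = n \<and> card (pverts G - X) = m \<and>
        (\<forall>x\<in>pverts G. \<forall>y\<in>pverts G. (x, y) \<in> parcs G \<longleftrightarrow> x \<noteq> y \<and> (x \<in> X \<longleftrightarrow> y \<in> X)))"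
      using no' by blast
    then show ?thesis
      by (intro that[of "pverts G - S" n m] non_split_degrees.intro)
        (use S SS basic False pos in simp_all)
  qed
qed

theorem proposition3:
  fixes G :: "'a pair_pre_digraph" and m n :: nat
  assumes "m > 0" and "n > 0"
    and "G \<in> clique_union_class m n"
  shows "(cut_vertices G = {} \<and> bridges G = {} \<or>
          card (cut_vertices G) = 1 \<and> bridges G = {} \<or>
          card (cut_vertices G) = 2 \<and> card (bridges G) = 1 \<or>
          card (cut_vertices G) = 2 \<and> card (bridges G) = 2 \<or>
          card (cut_vertices G) = 3 \<and> card (bridges G) = 4)
       \<and> (cut_vertices G \<noteq> {} \<longrightarrow> traceable G)"
proof -
  have pg: "pair_graph G" using assms(3) by (simp add: clique_union_class_def)
  then interpret G: pair_graph G .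
  obtain S a b where "non_split_degrees (pverts G) (parcs G) S a b"
    using clique_union_class_degrees[OF assms(3,1,2)] .
  then interpret non_split_degrees "pverts G" "parcs G" S a b .
  note cuts = pair_graph_cut_vertices[OF pg linked] and bridges = pair_graph_bridges[OF pg linked]
  show ?thesis
  proof (cases "cut_vertices G = {}")
    case True
    have "linked (pverts G - {v}) (parcs G)" if v: "v \<in> pverts G" for v
    proof -
      have "pverts G \<noteq> {v}" using card_V m_pos m_le_n by auto
      then show ?thesis using True v unfolding cuts by blast
    qed
    moreover have "pverts G \<noteq> {x, y}" if "(x, y) \<in> parcs G" for x y
    proof
      assume V: "pverts G = {x, y}"
      then have "x \<noteq> y" "x \<in> pverts G" using that irrefl by auto
      then have "a + b = 2" using V card_V by simp
      then have "card (parcs G `` {x}) = 0"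
        using deg_le[OF \<open>x \<in> pverts G\<close>] m_pos m_le_n by simp
      then show False using that finite_sub[of "parcs G `` {x}"] nbhd[of x] by auto
    qed
    ultimately have "linked (pverts G) (parcs G - {(x, y), (y, x)})" if "(x, y) \<in> parcs G" for x y
      using no_bridge_of_no_cut_vertex[OF E sym] that irrefl by blast
    then have "bridges G = {}" unfolding bridges by blast
    with True show ?thesis by simp
  next
    case False
    then obtain v where v: "v \<in> pverts G" "pverts G \<noteq> {v}" "\<not> linked (pverts G - {v}) (parcs G)"
      unfolding cuts by blast
    from cut_vertex_layering[OF this] obtain l p q where lay:
      "layered (pverts G) (parcs G) l" "l ` pverts G \<subseteq> {..4}" "0 < p" "0 < q"
      "map (\<lambda>i. card (layer (pverts G) l i)) [0..<5] \<in> {[p, 1, q, p, 1], [p, q, 1, p, q]}" .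
    have "bridges G \<subseteq> (\<lambda>(u, v). {u, v}) ` parcs G" unfolding bridges by auto
    then have "finite (bridges G)" using G.pair_finite_arcs by (rule finite_surj[rotated])
    then show ?thesis using cut_vertices_bridges_of_layering[OF pg lay] by auto
  qed
qed

end
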